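(* Let $(X,\bullet)$ be a strong groupoid. Then the $UA$-factorization of $(X,\bullet)$ is unique: there is exactly one pair of groupoids $(X,\ast)$, $(X,\circ)$ such that $(X,\ast)$ is a signature-factor of $(X,\bullet)$, $(X,\circ)$ is a similar-factor of $(X,\bullet)$, and $(X,\bullet)=(X,\ast)\diamond(X,\circ)$.
   Context: A groupoid $(X,\bullet)$ is a non-empty set $X$ with an arbitrary binary operation $\bullet:X\times X\to X$. It is strong if for all $x,y\in X$, $x\bullet y=y\bullet x$ implies $x=y$. For groupoids $(X,\ast)$, $(X,\circ)$ on the same set $X$, the product $(X,\ast)\diamond(X,\circ)$ is the groupoid $(X,\cdot)$ with $x\cdot y=(x\ast y)\circ(y\ast x)$ for all $x,y\in X$. A groupoid $(X,\ast)$ is a signature-factor of $(X,\bullet)$ if $x\ast x=x$ for all $x$ and $x\ast y=x\bullet y$ for all $x\neq y$. A groupoid $(X,\circ)$ is a similar-factor of $(X,\bullet)$ if $x\circ x=x\bullet x$ for all $x$ and $x\circ y=x$ for all $x\neq y$. *)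

theory Defs
  imports "HOL-Library.FuncSet"
begin

text \<open>
  A groupoid is given by its carrier \<open>X\<close> and a curried operation on it. Operations are
  extensional, i.e. \<open>undefined\<close> outside the carrier, so that HOL equality of
  operations is equality of groupoids on \<open>X\<close>. In the predicates for factors, the factored
  groupoid \<open>b\<close> precedes its factors.
\<close>

definition groupoid :: "'a set \<Rightarrow> ('a \<Rightarrow> 'a \<Rightarrow> 'a) \<Rightarrow> bool" where
  "groupoid X f \<longleftrightarrow> X \<noteq> {} \<and> f \<in> X \<rightarrow>\<^sub>E X \<rightarrow>\<^sub>E X"

definition strong_groupoid :: "'a set \<Rightarrow> ('a \<Rightarrow> 'a \<Rightarrow> 'a) \<Rightarrow> bool" where
  "strong_groupoid X f \<longleftrightarrow>
     groupoid X f \<and> (\<forall>x\<in>X. \<forall>y\<in>X. f x y = f y x \<longrightarrow> x = y)"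

definition groupoid_product ::
  "'a set \<Rightarrow> ('a \<Rightarrow> 'a \<Rightarrow> 'a) \<Rightarrow> ('a \<Rightarrow> 'a \<Rightarrow> 'a) \<Rightarrow> 'a \<Rightarrow> 'a \<Rightarrow> 'a" where
  "groupoid_product X f g = (\<lambda>x\<in>X. \<lambda>y\<in>X. g (f x y) (f y x))"

definition signature_factor :: "'a set \<Rightarrow> ('a \<Rightarrow> 'a \<Rightarrow> 'a) \<Rightarrow> ('a \<Rightarrow> 'a \<Rightarrow> 'a) \<Rightarrow> bool" where
  "signature_factor X b f \<longleftrightarrow>
     groupoid X f \<and> (\<forall>x\<in>X. f x x = x) \<and> (\<forall>x\<in>X. \<forall>y\<in>X. x \<noteq> y \<longrightarrow> f x y = b x y)"

definition similar_factor :: "'a set \<Rightarrow> ('a \<Rightarrow> 'a \<Rightarrow> 'a) \<Rightarrow> ('a \<Rightarrow> 'a \<Rightarrow> 'a) \<Rightarrow> bool" where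
  "similar_factor X b g \<longleftrightarrow>
     groupoid X g \<and> (\<forall>x\<in>X. g x x = b x x) \<and> (\<forall>x\<in>X. \<forall>y\<in>X. x \<noteq> y \<longrightarrow> g x y = x)"

definition UA_factorization ::
  "'a set \<Rightarrow> ('a \<Rightarrow> 'a \<Rightarrow> 'a) \<Rightarrow> ('a \<Rightarrow> 'a \<Rightarrow> 'a) \<Rightarrow> ('a \<Rightarrow> 'a \<Rightarrow> 'a) \<Rightarrow> bool" where
  "UA_factorization X b f g \<longleftrightarrow>
     signature_factor X b f \<and> similar_factor X b g \<and> b = groupoid_product X f g"

end

theory Submission
  imports Defs
begin

text \<open>A signature-factor has the identity on the diagonal and \<open>b\<close> off it; a
  similar-factor has \<open>b\<close> on the diagonal and the left projection off it. Each thus has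
  its value prescribed at every pair, which gives uniqueness
  (\<open>signature_factor_unique\<close>, \<open>similar_factor_unique\<close>), and these
  prescriptions define groupoids on \<open>X\<close>, which gives existence. What remains is that
  the product of the two factors is \<open>b\<close>, and this is where strongness enters
  (\<open>strong_groupoid_eq_product\<close>).\<close>

lemma groupoid_closed: "groupoid X f \<Longrightarrow> x \<in> X \<Longrightarrow> y \<in> X \<Longrightarrow> f x y \<in> X"
  unfolding groupoid_def by blast

text \<open>Operations are extensional in both arguments, so agreement on \<open>X\<close> is enough
  for HOL equality; \<open>PiE_ext\<close> is applied once per argument.\<close>

lemma groupoid_eqI:
  assumes "groupoid X f" "groupoid X g"
    and eq: "\<And>x y. x \<in> X \<Longrightarrow> y \<in> X \<Longrightarrow> f x y = g x y"
  shows "f = g"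
proof (rule PiE_ext)
  show f: "f \<in> X \<rightarrow>\<^sub>E X \<rightarrow>\<^sub>E X" and g: "g \<in> X \<rightarrow>\<^sub>E X \<rightarrow>\<^sub>E X"
    using assms(1,2) by (auto simp: groupoid_def)
  fix x assume x: "x \<in> X"
  show "f x = g x"
    by (rule PiE_ext[OF PiE_mem[OF f x] PiE_mem[OF g x]]) (rule eq[OF x])
qed

lemma groupoid_restrict:
  assumes "X \<noteq> {}" "\<And>x y. x \<in> X \<Longrightarrow> y \<in> X \<Longrightarrow> f x y \<in> X"
  shows "groupoid X (\<lambda>x\<in>X. \<lambda>y\<in>X. f x y)"
  unfolding groupoid_def using assms by (auto intro!: restrict_PiE_iff[THEN iffD2])

lemma groupoid_product_groupoid:
  assumes "groupoid X f" "groupoid X g"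
  shows "groupoid X (groupoid_product X f g)"
  unfolding groupoid_product_def
proof (rule groupoid_restrict)
  show "X \<noteq> {}" using assms(1) by (simp add: groupoid_def)
qed (use assms in \<open>simp add: groupoid_closed\<close>)

lemma signature_factor_unique:
  assumes "signature_factor X b f" "signature_factor X b f'"
  shows "f = f'"
proof (rule groupoid_eqI)
  show "groupoid X f" "groupoid X f'"
    using assms by (simp_all add: signature_factor_def)
  show "f x y = f' x y" if "x \<in> X" "y \<in> X" for x y
    using assms that unfolding signature_factor_def by (cases "x = y") simp_all
qed

lemma similar_factor_unique:
  assumes "similar_factor X b g" "similar_factor X b g'"
  shows "g = g'"
proof (rule groupoid_eqI)
  show "groupoid X g" "groupoid X g'"
    using assms by (simp_all add: similar_factor_def)
  show "g x y = g' x y" if "x \<in> X" "y \<in> X" for x y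
    using assms that unfolding similar_factor_def by (cases "x = y") simp_all
qed

lemma signature_factor_exists:
  assumes "groupoid X b"
  obtains f where "signature_factor X b f"
proof
  \<comment> \<open>The witness is read off the two defining clauses; restricting it to
    \<open>X\<close> makes it extensional.\<close>
  have "groupoid X (\<lambda>x\<in>X. \<lambda>y\<in>X. if x = y then x else b x y)"
    by (rule groupoid_restrict) (use assms in \<open>auto simp: groupoid_closed groupoid_def\<close>)
  then show "signature_factor X b (\<lambda>x\<in>X. \<lambda>y\<in>X. if x = y then x else b x y)"
    by (simp add: signature_factor_def)
qed

lemma similar_factor_exists:
  assumes "groupoid X b"
  obtains g where "similar_factor X b g"
proof
  have "groupoid X (\<lambda>x\<in>X. \<lambda>y\<in>X. if x = y then b x x else x)"
    by (rule groupoid_restrict) (use assms in \<open>auto simp: groupoid_closed groupoid_def\<close>)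
  then show "similar_factor X b (\<lambda>x\<in>X. \<lambda>y\<in>X. if x = y then b x x else x)"
    by (simp add: similar_factor_def)
qed

text \<open>
  Strongness gives \<open>b x y \<noteq> b y x\<close> for \<open>x \<noteq> y\<close>, so off the diagonal the similar-factor
  acts as the left projection on the pair of these two products.
\<close>
lemma strong_groupoid_eq_product:
  assumes b: "strong_groupoid X b" and f: "signature_factor X b f" and g: "similar_factor X b g"
  shows "b = groupoid_product X f g"
proof (rule groupoid_eqI)
  show gb: "groupoid X b" using b by (simp add: strong_groupoid_def)
  show "groupoid X (groupoid_product X f g)"
    using f g by (simp add: groupoid_product_groupoid signature_factor_def similar_factor_def)
  show "b x y = groupoid_product X f g x y" if xy: "x \<in> X" "y \<in> X" for x y
  proof (cases "x = y")
    case True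
    \<comment> \<open>On the diagonal \<open>f x x = x\<close>, so the product is
      \<open>g x x\<close>, which is \<open>b x x\<close>.\<close>
    then show ?thesis
      using f g xy by (simp add: groupoid_product_def signature_factor_def similar_factor_def)
  next
    case False
    then have "b x y \<noteq> b y x"
      using b xy by (auto simp: strong_groupoid_def)
    then have "g (b x y) (b y x) = b x y"
      \<comment> \<open>Closure is needed because \<open>g\<close> is known to project only on
        distinct elements of \<open>X\<close>.\<close>
      using g groupoid_closed[OF gb] xy by (simp add: similar_factor_def)
    then show ?thesis
      using f xy False by (simp add: groupoid_product_def signature_factor_def)
  qed
qed

theorem corollary3p1p4:
  fixes X :: "'a set" and b :: "'a \<Rightarrow> 'a \<Rightarrow> 'a"
  assumes "strong_groupoid X b"
  shows "\<exists>!p. UA_factorization X b (fst p) (snd p)"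
proof -
  have gb: "groupoid X b" using assms by (simp add: strong_groupoid_def)
  obtain f where f: "signature_factor X b f" using signature_factor_exists[OF gb] .
  obtain g where g: "similar_factor X b g" using similar_factor_exists[OF gb] .
  show ?thesis
  proof (rule ex1I[of _ "(f, g)"])
    show "UA_factorization X b (fst (f, g)) (snd (f, g))"
      using f g strong_groupoid_eq_product[OF assms f g] by (simp add: UA_factorization_def)
    \<comment> \<open>The components of \<open>p\<close> are pinned down separately, each by its own
      uniqueness lemma.\<close>
    show "p = (f, g)" if "UA_factorization X b (fst p) (snd p)" for p
      using that signature_factor_unique[OF _ f] similar_factor_unique[OF _ g]
      unfolding UA_factorization_def prod_eq_iff fst_conv snd_conv by blast
  qed
qed

end
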